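(* Let $\omega:\mathbb{Z}\to\mathbb{R}^+$ be a growth rate. If the system $x(k+1)=A(k)x(k)$, $k\in\mathbb{Z}$, has $\omega$-bounded growth, then it does not admit a $\mu$-dichotomy for any growth rate $\mu:\mathbb{Z}\to\mathbb{R}^+$ which is faster than $\omega$.
   Context: System: $A:\mathbb{Z}\to GL_d(\mathbb{R})$, and $x(k+1)=A(k)x(k)$, $k\in\mathbb{Z}$. Its evolution operator is $\Phi(k,n)=A(k-1)\cdots A(n)$ for $k>n$, $\Phi(n,n)=\mathrm{Id}$, $\Phi(k,n)=A^{-1}(k)\cdots A^{-1}(n-1)$ for $k<n$. Growth rate: a non-decreasing map $\mu:\mathbb{Z}\to\mathbb{R}^+=(0,\infty)$ with $\mu(0)=1$, $\lim_{n\to+\infty}\mu(n)=+\infty$, $\lim_{n\to-\infty}\mu(n)=0$. Faster: $\mu$ is faster than $\omega$ if for every $\alpha,\tilde\alpha<0$ there is $M\ge1$ such that $\left(\frac{\mu(k)}{\mu(n)}\right)^{\alpha}\le M\left(\frac{\omega(k)}{\omega(n)}\right)^{\tilde\alpha}$ for all integers $k\ge n$. $\omega$-bounded growth: there are constants $\hat K\ge1$, $a\ge0$ with $\|\Phi(k,n)\|\le\hat K\left(\frac{\omega(k)}{\omega(n)}\right)^{\mathrm{sgn}(k-n)a}$ for all $k,n\in\mathbb{Z}$, where $\mathrm{sgn}(j)=1,0,-1$ for $j>0$, $j=0$, $j<0$ respectively. Invariant projector: a map $n\mapsto \mathrm{P}(n)$ of idempotent $d\times d$ matrices with $A(k)\mathrm{P}(k)=\mathrm{P}(k+1)A(k)$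 for all $k\in\mathbb{Z}$. $\mu$-dichotomy: there are an invariant projector $\mathrm{P}$ and constants $K\ge1$, $\alpha<0$, $\beta>0$ with $\|\Phi(k,n)\mathrm{P}(n)\|\le K\left(\frac{\mu(k)}{\mu(n)}\right)^{\alpha}$ for all $k\ge n$ and $\|\Phi(k,n)[\mathrm{Id}-\mathrm{P}(n)]\|\le K\left(\frac{\mu(k)}{\mu(n)}\right)^{\beta}$ for all $k\le n$. *)

theory Defs
  imports "HOL-Analysis.Analysis"
begin

text \<open>
  A system \<open>x (k + 1) = A k *v x k\<close> is given by its coefficients
  \<open>A :: int \<Rightarrow> real^'d^'d\<close>; that each \<open>A k\<close> lies in \<open>GL\<^sub>d\<close> is the separate predicate
  \<open>nonsingular_system A\<close>.
\<close>

definition nonsingular_system :: "(int \<Rightarrow> real^'d^'d) \<Rightarrow> bool" where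
  "nonsingular_system A \<longleftrightarrow> (\<forall>k. invertible (A k))"

text \<open>The product \<open>A (n + j - 1) ** \<dots> ** A n\<close> of \<open>j\<close> factors.\<close>

primrec forward_product :: "(int \<Rightarrow> real^'d^'d) \<Rightarrow> int \<Rightarrow> nat \<Rightarrow> real^'d^'d" where
  "forward_product A n 0 = mat 1"
| "forward_product A n (Suc j) = A (n + int j) ** forward_product A n j"

text \<open>The product \<open>matrix_inv (A (n - j)) ** \<dots> ** matrix_inv (A (n - 1))\<close> of \<open>j\<close> factors.\<close>

primrec backward_product :: "(int \<Rightarrow> real^'d^'d) \<Rightarrow> int \<Rightarrow> nat \<Rightarrow> real^'d^'d" where
  "backward_product A n 0 = mat 1"
| "backward_product A n (Suc j) = matrix_inv (A (n - int (Suc j))) ** backward_product A n j"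

definition evolution :: "(int \<Rightarrow> real^'d^'d) \<Rightarrow> int \<Rightarrow> int \<Rightarrow> real^'d^'d" where
  "evolution A k n =
    (if k > n then forward_product A n (nat (k - n))
     else if k = n then mat 1
     else backward_product A n (nat (n - k)))"

text \<open>
  The library's \<open>norm\<close> on \<open>real^'d^'d\<close> is the Frobenius norm; this is the operator norm induced
  by the Euclidean norm.
\<close>

definition matrix_norm :: "real^'d^'d \<Rightarrow> real" where
  "matrix_norm B = onorm (\<lambda>x. B *v x)"

definition growth_rate :: "(int \<Rightarrow> real) \<Rightarrow> bool" where
  "growth_rate \<mu> \<longleftrightarrow>
    (\<forall>n. \<mu> n > 0) \<and> mono \<mu> \<and> \<mu> 0 = 1 \<and>
    filterlim \<mu> at_top at_top \<and> (\<mu> \<longlongrightarrow> 0) at_bot"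

definition faster :: "(int \<Rightarrow> real) \<Rightarrow> (int \<Rightarrow> real) \<Rightarrow> bool" where
  "faster \<mu> \<omega> \<longleftrightarrow>
    (\<forall>\<alpha><0. \<forall>\<alpha>'<0. \<exists>M\<ge>1. \<forall>k n. k \<ge> n \<longrightarrow>
      (\<mu> k / \<mu> n) powr \<alpha> \<le> M * (\<omega> k / \<omega> n) powr \<alpha>')"

definition bounded_growth :: "(int \<Rightarrow> real) \<Rightarrow> (int \<Rightarrow> real^'d^'d) \<Rightarrow> bool" where
  "bounded_growth \<omega> A \<longleftrightarrow>
    (\<exists>K\<ge>1. \<exists>a\<ge>0. \<forall>k n.
      matrix_norm (evolution A k n) \<le> K * (\<omega> k / \<omega> n) powr (real_of_int (sgn (k - n)) * a))"

definition invariant_projector :: "(int \<Rightarrow> real^'d^'d) \<Rightarrow> (int \<Rightarrow> real^'d^'d) \<Rightarrow> bool" where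
  "invariant_projector A P \<longleftrightarrow>
    (\<forall>n. P n ** P n = P n) \<and> (\<forall>k. A k ** P k = P (k + 1) ** A k)"

definition admits_dichotomy :: "(int \<Rightarrow> real) \<Rightarrow> (int \<Rightarrow> real^'d^'d) \<Rightarrow> bool" where
  "admits_dichotomy \<mu> A \<longleftrightarrow>
    (\<exists>P K \<alpha> \<beta>. invariant_projector A P \<and> K \<ge> 1 \<and> \<alpha> < 0 \<and> \<beta> > 0 \<and>
      (\<forall>k n. k \<ge> n \<longrightarrow>
        matrix_norm (evolution A k n ** P n) \<le> K * (\<mu> k / \<mu> n) powr \<alpha>) \<and>
      (\<forall>k n. k \<le> n \<longrightarrow>
        matrix_norm (evolution A k n ** (mat 1 - P n)) \<le> K * (\<mu> k / \<mu> n) powr \<beta>))"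

end

theory Submission imports Defs begin

text \<open>
  A dichotomy at time \<open>0\<close> splits the space into the ranges of \<open>P 0\<close> and \<open>mat 1 - P 0\<close>, and at
  least one of these is nonzero. A nonzero vector \<open>x\<close> in one of them decays along the system at
  the rate of a power of \<open>\<mu>\<close>, in forward time for the first range and in backward time for the
  second. Bounded growth limits how fast the way back can recover the lost norm: at most like the
  power \<open>a\<close> of \<open>\<omega> k\<close> in the first case and of \<open>1 / \<omega> k\<close> in the second. Since the round trip
  from \<open>0\<close> to \<open>k\<close> and back returns \<open>x\<close> itself, the product of the norms of the two legs is at
  least \<open>1\<close> (\<open>one_le_round_trip_norm\<close>). But if \<open>\<mu>\<close> is faster than \<open>\<omega>\<close>, then the decay beats
  even the power \<open>a + 1\<close>, so the product is bounded by a constant times \<open>1 / \<omega> k\<close> as \<open>k\<close> tends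
  to \<open>\<infinity>\<close>, or times \<open>\<omega> k\<close> as \<open>k\<close> tends to \<open>-\<infinity>\<close>. Both bounds tend to \<open>0\<close>, a contradiction.
\<close>

lemma matrix_inv_cancel_left:
  fixes B :: "real^'d^'d"
  assumes "invertible B"
  shows "matrix_inv B ** (B ** C) = C" and "B ** (matrix_inv B ** C) = C"
proof -
  have "B ** matrix_inv B = mat 1 \<and> matrix_inv B ** B = mat 1"
    using someI_ex[OF assms[unfolded invertible_def]] by (simp add: matrix_inv_def)
  then show "matrix_inv B ** (B ** C) = C" and "B ** (matrix_inv B ** C) = C"
    by (simp_all add: matrix_mul_assoc)
qed

text \<open>
  Each inverse factor cancels the outermost factor of the forward product. Stopping after \<open>i\<close>
  of the \<open>j\<close> factors is what makes an induction possible, since both products are built up by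
  multiplication from the left.
\<close>

lemma backward_product_cancels_forward_product:
  assumes "nonsingular_system A" and "i \<le> j"
  shows "backward_product A (n + int j) i ** forward_product A n j = forward_product A n (j - i)"
  using assms(2)
proof (induction i)
  case 0
  then show ?case by simp
next
  case (Suc i)
  let ?m = "j - Suc i"
  have m: "j - i = Suc ?m" and time: "n + int j - int (Suc i) = n + int ?m"
    using Suc.prems by auto
  have "backward_product A (n + int j) (Suc i) ** forward_product A n j
      = matrix_inv (A (n + int ?m)) ** forward_product A n (j - i)"
    using Suc by (simp only: backward_product.simps time matrix_mul_assoc[symmetric])
  also have "\<dots> = forward_product A n ?m"
    using assms(1)
    by (simp only: m forward_product.simps) (simp add: nonsingular_system_def matrix_inv_cancel_left)
  finally show ?case .
qed

lemma forward_product_cancels_backward_product: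
  assumes "nonsingular_system A" and "i \<le> j"
  shows "forward_product A (n - int j) i ** backward_product A n j = backward_product A n (j - i)"
  using assms(2)
proof (induction i)
  case 0
  then show ?case by simp
next
  case (Suc i)
  let ?m = "j - Suc i"
  have m: "j - i = Suc ?m" and time: "n - int j + int i = n - int (Suc ?m)"
    using Suc.prems by auto
  have "forward_product A (n - int j) (Suc i) ** backward_product A n j
      = A (n - int (Suc ?m)) ** backward_product A n (j - i)"
    using Suc by (simp only: forward_product.simps time matrix_mul_assoc[symmetric])
  also have "\<dots> = backward_product A n ?m"
    using assms(1)
    by (simp only: m backward_product.simps) (simp add: nonsingular_system_def matrix_inv_cancel_left)
  finally show ?case .
qed

lemma evolution_round_trip:
  assumes "nonsingular_system A"
  shows "evolution A n k ** evolution A k n = mat 1"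
proof (cases k n rule: linorder_cases)
  case less
  then show ?thesis
    using forward_product_cancels_backward_product[OF assms order_refl, of n "nat (n - k)"]
    by (simp add: evolution_def)
next
  case equal
  then show ?thesis by (simp add: evolution_def)
next
  case greater
  then show ?thesis
    using backward_product_cancels_forward_product[OF assms order_refl, of n "nat (k - n)"]
    by (simp add: evolution_def)
qed

lemma norm_matrix_vector_le_matrix_norm: "norm (B *v x) \<le> matrix_norm B * norm x"
  unfolding matrix_norm_def by (rule onorm) (simp add: linear_linear)

lemma matrix_norm_nonneg: "0 \<le> matrix_norm B"
  unfolding matrix_norm_def by (rule onorm_pos_le) (simp add: linear_linear)

text \<open>
  Transporting a nonzero vector of the range of \<open>Q\<close> from time \<open>n\<close> to time \<open>k\<close> and back changes
  nothing, so the two legs cannot both be strong contractions.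
\<close>

lemma one_le_round_trip_norm:
  assumes "nonsingular_system A" and "Q ** Q = Q" and "Q \<noteq> 0"
  shows "1 \<le> matrix_norm (evolution A n k) * matrix_norm (evolution A k n ** Q)"
proof -
  obtain y where "Q *v y \<noteq> 0"
    using assms(3) by (metis matrix_eq matrix_vector_mult_0)
  define x where "x = Q *v y"
  have x: "x \<noteq> 0" "Q *v x = x"
    using \<open>Q *v y \<noteq> 0\<close> assms(2) by (simp_all add: x_def matrix_vector_mul_assoc)
  have "norm x = norm (evolution A n k *v ((evolution A k n ** Q) *v x))"
    using evolution_round_trip[OF assms(1), of n k] x(2)
    by (metis matrix_vector_mul_assoc matrix_vector_mul_lid)
  also have "\<dots> \<le> matrix_norm (evolution A n k) * norm ((evolution A k n ** Q) *v x)"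
    by (rule norm_matrix_vector_le_matrix_norm)
  also have "\<dots> \<le> matrix_norm (evolution A n k) * (matrix_norm (evolution A k n ** Q) * norm x)"
    by (intro mult_left_mono norm_matrix_vector_le_matrix_norm matrix_norm_nonneg)
  finally show ?thesis
    using x(1) by simp
qed

text \<open>
  In the application \<open>r\<close> and \<open>c\<close> are the norms of the return leg and of the contracting leg,
  \<open>m\<close> is the power of \<open>\<mu>\<close> that bounds the contraction, and \<open>w\<close> is \<open>\<omega> k\<close> in forward time and
  \<open>1 / \<omega> k\<close> in backward time. The return leg regains at most the power \<open>a\<close> of \<open>w\<close>, whereas the
  contracting leg loses the power \<open>a + 1\<close>, so one power of \<open>w\<close> is missing and the constants have
  to make up for it.
\<close>

lemma round_trip_powr_bound:
  fixes w :: real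
  assumes "1 \<le> r * c" and "0 \<le> r" and "0 < w" and "0 \<le> K" and "0 \<le> M"
    and "r \<le> L * w powr a" and "c \<le> K * m" and "m \<le> M * w powr (- (a + 1))"
  shows "w \<le> L * K * M"
proof -
  have "c \<le> K * (M * w powr (- (a + 1)))"
    using assms(4,7,8) mult_left_mono order_trans by blast
  then have "1 \<le> r * (K * (M * w powr (- (a + 1))))"
    using assms(1,2) mult_left_mono order_trans by blast
  moreover have "0 \<le> K * (M * w powr (- (a + 1)))"
    using assms(4,5) by simp
  ultimately have "1 \<le> L * w powr a * (K * (M * w powr (- (a + 1))))"
    using assms(6) mult_right_mono order_trans by blast
  also have "\<dots> = L * K * M * (w powr a * w powr (- (a + 1)))"
    by (simp add: mult_ac)
  also have "w powr a * w powr (- (a + 1)) = inverse w"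
    using assms(3) by (simp flip: powr_add add: powr_minus)
  finally show ?thesis
    using assms(3) by (simp add: field_simps)
qed

theorem corollary3p11:
  fixes A :: "int \<Rightarrow> real^'d^'d" and \<omega> :: "int \<Rightarrow> real"
  assumes "nonsingular_system A"
    and "growth_rate \<omega>"
    and "bounded_growth \<omega> A"
  shows "\<forall>\<mu>. growth_rate \<mu> \<longrightarrow> faster \<mu> \<omega> \<longrightarrow> \<not> admits_dichotomy \<mu> A"
proof (intro allI impI notI)
  fix \<mu>
  assume \<mu>: "growth_rate \<mu>" and faster: "faster \<mu> \<omega>" and "admits_dichotomy \<mu> A"
  then obtain P K \<alpha> \<beta> where P: "invariant_projector A P" and K: "K \<ge> 1"
    and \<alpha>: "\<alpha> < 0" and \<beta>: "\<beta> > 0"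
    and stable: "\<And>k n. k \<ge> n \<Longrightarrow>
        matrix_norm (evolution A k n ** P n) \<le> K * (\<mu> k / \<mu> n) powr \<alpha>"
    and unstable: "\<And>k n. k \<le> n \<Longrightarrow>
        matrix_norm (evolution A k n ** (mat 1 - P n)) \<le> K * (\<mu> k / \<mu> n) powr \<beta>"
    unfolding admits_dichotomy_def by blast
  obtain L a where L: "L \<ge> 1" and a: "a \<ge> 0"
    and growth: "\<And>k n. matrix_norm (evolution A k n)
        \<le> L * (\<omega> k / \<omega> n) powr (real_of_int (sgn (k - n)) * a)"
    using assms(3) unfolding bounded_growth_def by blast
  have \<omega>0: "\<omega> 0 = 1" and \<omega>_pos: "\<And>k. \<omega> k > 0"
    and \<omega>_top: "filterlim \<omega> at_top at_top" and \<omega>_bot: "(\<omega> \<longlongrightarrow> 0) at_bot"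
    and \<mu>0: "\<mu> 0 = 1" and \<mu>_pos: "\<And>k. \<mu> k > 0"
    using assms(2) \<mu> unfolding growth_rate_def by auto
  have idem: "P 0 ** P 0 = P 0"
    using P unfolding invariant_projector_def by blast
  show False
  proof (cases "P 0 = 0")
    case False
    obtain M where "M \<ge> 1"
      and M: "\<And>k n. k \<ge> n \<Longrightarrow> (\<mu> k / \<mu> n) powr \<alpha> \<le> M * (\<omega> k / \<omega> n) powr (- (a + 1))"
      using faster \<alpha> a unfolding faster_def by (meson add_nonneg_pos neg_less_0_iff_less zero_less_one)
    have bound: "\<omega> k \<le> L * K * M" if "k > 0" for k
    proof (rule round_trip_powr_bound)
      show "1 \<le> matrix_norm (evolution A 0 k) * matrix_norm (evolution A k 0 ** P 0)"
        by (rule one_le_round_trip_norm[OF assms(1) idem False])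
      show "matrix_norm (evolution A 0 k) \<le> L * \<omega> k powr a"
        using growth[of 0 k] that \<omega>_pos[of k] \<omega>0
        by (simp add: powr_minus powr_divide)
      show "matrix_norm (evolution A k 0 ** P 0) \<le> K * \<mu> k powr \<alpha>"
        using stable[of 0 k] that \<mu>0 by simp
      show "\<mu> k powr \<alpha> \<le> M * \<omega> k powr (- (a + 1))"
        using M[of 0 k] that \<mu>0 \<omega>0 by simp
    qed (use \<omega>_pos K \<open>M \<ge> 1\<close> in \<open>auto simp: matrix_norm_nonneg\<close>)
    have "\<forall>\<^sub>F k in at_top. \<omega> k > L * K * M \<and> k > 0"
      using \<omega>_top by (auto simp: filterlim_at_top_dense eventually_gt_at_top intro: eventually_conj)
    then obtain k where "\<omega> k > L * K * M" "k > 0"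
      using eventually_happens trivial_limit_at_top_linorder by blast
    then show False
      using bound[of k] by simp
  next
    case True
    \<comment> \<open>The identity is nonzero because an index type is never empty.\<close>
    then have nonzero: "mat 1 - P 0 \<noteq> 0"
      by (metis diff_zero matrix_vector_mul_lid matrix_vector_mult_0 axis_eq_0_iff zero_neq_one)
    have idem': "(mat 1 - P 0) ** (mat 1 - P 0) = mat 1 - P 0"
      using True by simp
    obtain M where "M \<ge> 1"
      and M: "\<And>k n. k \<ge> n \<Longrightarrow> (\<mu> k / \<mu> n) powr (- \<beta>) \<le> M * (\<omega> k / \<omega> n) powr (- (a + 1))"
      using faster \<beta> a unfolding faster_def by (meson add_nonneg_pos neg_less_0_iff_less zero_less_one)
    have bound: "1 / \<omega> k \<le> L * K * M" if "k < 0" for k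
    proof (rule round_trip_powr_bound)
      show "1 \<le> matrix_norm (evolution A 0 k) * matrix_norm (evolution A k 0 ** (mat 1 - P 0))"
        by (rule one_le_round_trip_norm[OF assms(1) idem' nonzero])
      show "matrix_norm (evolution A 0 k) \<le> L * (1 / \<omega> k) powr a"
        using growth[of 0 k] that \<omega>0 by simp
      show "matrix_norm (evolution A k 0 ** (mat 1 - P 0)) \<le> K * \<mu> k powr \<beta>"
        using unstable[of k 0] that \<mu>0 by simp
      show "\<mu> k powr \<beta> \<le> M * (1 / \<omega> k) powr (- (a + 1))"
        using M[of k 0] that \<mu>0 \<omega>0 \<mu>_pos[of k] by (simp add: powr_minus powr_divide)
    qed (use \<omega>_pos K \<open>M \<ge> 1\<close> in \<open>auto simp: matrix_norm_nonneg\<close>)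
    have C: "L * K * M > 0"
      using L K \<open>M \<ge> 1\<close> by simp
    have "\<forall>\<^sub>F k in at_bot. k < (0 :: int)"
      using eventually_le_at_bot[of "-1 :: int"] by (rule eventually_mono) simp
    then have "\<forall>\<^sub>F k in at_bot. \<omega> k < 1 / (L * K * M) \<and> k < 0"
      using order_tendstoD(2)[OF \<omega>_bot, of "1 / (L * K * M)"] C
      by (simp add: eventually_conj_iff)
    then obtain k where "\<omega> k < 1 / (L * K * M)" "k < 0"
      using eventually_happens trivial_limit_at_bot_linorder by blast
    then show False
      using bound[of k] C \<omega>_pos[of k] by (simp add: field_simps)
  qed
qed

end
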